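(* Let $G=(V,E)$ be a connected graph of order $n>2$ with Laplacian eigenvalues $\lambda_1\ge\lambda_2\ge\cdots\ge\lambda_n$. Given a vertex subset $U\subset V$, with $m=|U|<n$, let $G[U]=(U,E[U])$ and $G[\overline{U}]$ be the subgraphs of $G$ induced by $U$ and by $\overline{U}$, respectively. Let $\vartheta_1$ be the largest Laplacian eigenvalue of $G[\overline{U}]$. Then $$\sum_{i=1}^{m+1}\lambda_i\;\ge\;\sum_{u\in U}d_u+m-|E[U]|+\vartheta_1 .$$
   Context: All graphs are finite and simple. The Laplacian eigenvalues of a graph are the eigenvalues (with multiplicity) of $L=D-A$, where $D$ is the diagonal matrix of vertex degrees and $A$ is the adjacency matrix of that graph. $d_u$ is the degree in $G$ of the vertex $u$. $\overline{U}=V\setminus U$, and $E[U]$ is the set of edges of $G$ with both endpoints in $U$. *)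

theory Defs
  imports
    "Graph_Theory.Digraph_Component"
    "Jordan_Normal_Form.Char_Poly"
begin

text \<open>
  A finite simple graph is a digraph satisfying \<^locale>\<open>graph\<close>: finite, loop-free, without
  parallel arcs, and symmetric. Each undirected edge is thus a pair of opposite arcs, so that
  \<^const>\<open>out_degree\<close> is the usual vertex degree, whereas undirected edges have to be counted
  as unordered pairs of endpoints.
\<close>

definition edges :: "('a, 'b) pre_digraph \<Rightarrow> 'a set set" where
  "edges G = {{u, v} | u v. u \<rightarrow>\<^bsub>G\<^esub> v}"

text \<open>In the following matrices the list \<open>vs\<close> enumerates the vertices, without repetition.\<close>

definition degree_matrix :: "('a, 'b) pre_digraph \<Rightarrow> 'a list \<Rightarrow> real mat" where
  "degree_matrix G vs = mat (length vs) (length vs)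
     (\<lambda>(i, j). if i = j then real (out_degree G (vs ! i)) else 0)"

definition adjacency_matrix :: "('a, 'b) pre_digraph \<Rightarrow> 'a list \<Rightarrow> real mat" where
  "adjacency_matrix G vs = mat (length vs) (length vs)
     (\<lambda>(i, j). if vs ! i \<rightarrow>\<^bsub>G\<^esub> vs ! j then 1 else 0)"

definition laplacian_matrix :: "('a, 'b) pre_digraph \<Rightarrow> 'a list \<Rightarrow> real mat" where
  "laplacian_matrix G vs = degree_matrix G vs - adjacency_matrix G vs"

text \<open>
  The multiset of Laplacian eigenvalues. The choice of the enumeration is immaterial
  (\<open>laplacian_spectrum_eq\<close>), and since the matrix is real symmetric, its real characteristic
  roots are all of its eigenvalues (\<open>size_laplacian_spectrum\<close>).
\<close>

definition laplacian_spectrum :: "('a, 'b) pre_digraph \<Rightarrow> real multiset" where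
  "laplacian_spectrum G =
     proots (char_poly (laplacian_matrix G (SOME vs. distinct vs \<and> set vs = verts G)))"

text \<open>
  The \<open>i\<close>-th largest Laplacian eigenvalue, counted with multiplicity; meaningful for
  \<open>1 \<le> i \<le> card (verts G)\<close>.
\<close>

definition laplacian_eigenvalue :: "('a, 'b) pre_digraph \<Rightarrow> nat \<Rightarrow> real" where
  "laplacian_eigenvalue G i = rev (sorted_list_of_multiset (laplacian_spectrum G)) ! (i - 1)"

lemma laplacian_matrix_carrier [simp]:
  "laplacian_matrix G vs \<in> carrier_mat (length vs) (length vs)"
  unfolding laplacian_matrix_def degree_matrix_def adjacency_matrix_def
  by (intro minus_carrier_mat mat_carrier)

lemma laplacian_matrix_index:
  assumes "i < length vs" "j < length vs"
  shows "laplacian_matrix G vs $$ (i, j) =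
    (if i = j then real (out_degree G (vs ! i)) else 0) - (if vs ! i \<rightarrow>\<^bsub>G\<^esub> vs ! j then 1 else 0)"
  using assms by (simp add: laplacian_matrix_def degree_matrix_def adjacency_matrix_def)

lemma laplacian_matrix_similar:
  assumes "distinct vs" "distinct ws" "set vs = set ws"
  shows "similar_mat (laplacian_matrix G vs) (laplacian_matrix G ws)"
proof -
  obtain n where n_def: "length vs = n" by blast
  have n': "length ws = n" using assms by (metis distinct_card n_def)
  define P :: "real mat" where "P = mat n n (\<lambda>(i, j). if vs ! i = ws ! j then 1 else 0)"
  define Q :: "real mat" where "Q = mat n n (\<lambda>(i, j). if ws ! i = vs ! j then 1 else 0)"
  have key: "mat n n (\<lambda>(i, j). if xs ! i = ys ! j then 1 else (0::real)) *
      mat n n (\<lambda>(i, j). if ys ! i = xs ! j then 1 else 0) = 1\<^sub>m n"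
    if xs: "distinct xs" "length xs = n" and ys: "distinct ys" "length ys = n"
      and st: "set xs = set ys" for xs ys :: "'a list"
  proof (rule eq_matI)
    fix i j assume "i < dim_row (1\<^sub>m n :: real mat)" "j < dim_col (1\<^sub>m n :: real mat)"
    then have ij: "i < n" "j < n" by auto
    from ij obtain k where k: "k < n" "ys ! k = xs ! i"
      by (metis st in_set_conv_nth xs(2) ys(2))
    have eq: "xs ! i = ys ! l \<longleftrightarrow> l = k" if "l < n" for l
      using k that ys by (metis nth_eq_iff_index_eq)
    have "(\<Sum>l = 0..<n. (if xs ! i = ys ! l then 1 else (0::real)) * (if ys ! l = xs ! j then 1 else 0))
        = (\<Sum>l = 0..<n. if l = k then (if xs ! i = xs ! j then 1 else 0) else 0)"
      using k by (intro sum.cong) (auto simp: eq)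
    also have "\<dots> = (if i = j then 1 else 0)"
      using k ij xs by (simp add: nth_eq_iff_index_eq)
    finally show "(mat n n (\<lambda>(i, j). if xs ! i = ys ! j then 1 else (0::real)) *
      mat n n (\<lambda>(i, j). if ys ! i = xs ! j then 1 else 0)) $$ (i, j) = 1\<^sub>m n $$ (i, j)"
      using ij by (simp add: scalar_prod_def)
  qed auto
  have PQ: "P * Q = 1\<^sub>m n" "Q * P = 1\<^sub>m n"
    unfolding P_def Q_def
    using key[OF assms(1) n_def assms(2) n' assms(3)]
      key[OF assms(2) n' assms(1) n_def assms(3)[symmetric]] by simp_all
  have AP: "laplacian_matrix G vs * P = P * laplacian_matrix G ws" (is "?A * P = P * ?B")
  proof (rule eq_matI)
    fix i j assume "i < dim_row (P * ?B)" "j < dim_col (P * ?B)"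
    then have ij: "i < n" "j < n"
      using laplacian_matrix_carrier[of G ws] n' by (auto simp: P_def)
    obtain k where k: "k < n" "ws ! k = vs ! i" using ij assms n' n_def
      by (metis in_set_conv_nth)
    obtain h where h: "h < n" "vs ! h = ws ! j" using ij assms n' n_def
      by (metis in_set_conv_nth)
    have e1: "vs ! l = ws ! j \<longleftrightarrow> l = h" if "l < n" for l
      using h that assms n_def by (metis nth_eq_iff_index_eq)
    have e2: "vs ! i = ws ! l \<longleftrightarrow> l = k" if "l < n" for l
      using k that assms n' by (metis nth_eq_iff_index_eq)
    have "(?A * P) $$ (i, j) = (\<Sum>l = 0..<n. ?A $$ (i, l) * (if vs ! l = ws ! j then 1 else 0))"
      using ij laplacian_matrix_carrier[of G vs] n_def by (simp add: scalar_prod_def P_def)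
    also have "\<dots> = (\<Sum>l = 0..<n. if l = h then ?A $$ (i, h) else 0)"
      by (intro sum.cong) (auto simp: e1)
    also have "\<dots> = ?A $$ (i, h)" using h by simp
    also have "\<dots> = ?B $$ (k, j)"
      using ij h k assms n' n_def e1[of i] e2[of h] e1[of h]
      by (auto simp: laplacian_matrix_index nth_eq_iff_index_eq)
    also have "\<dots> = (\<Sum>l = 0..<n. if l = k then ?B $$ (k, j) else 0)" using k by simp
    also have "\<dots> = (\<Sum>l = 0..<n. (if vs ! i = ws ! l then 1 else 0) * ?B $$ (l, j))"
      by (intro sum.cong) (auto simp: e2)
    also have "\<dots> = (P * ?B) $$ (i, j)"
      using ij laplacian_matrix_carrier[of G ws] n' by (simp add: scalar_prod_def P_def)
    finally show "(?A * P) $$ (i, j) = (P * ?B) $$ (i, j)" .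
  qed (use laplacian_matrix_carrier[of G ws] laplacian_matrix_carrier[of G vs] n' n_def in
      \<open>auto simp: P_def\<close>)
  have c: "P \<in> carrier_mat n n" "Q \<in> carrier_mat n n" "?A \<in> carrier_mat n n" "?B \<in> carrier_mat n n"
    using laplacian_matrix_carrier[of G ws] laplacian_matrix_carrier[of G vs] n' n_def
    by (auto simp: P_def Q_def)
  have "P * ?B * Q = ?A * (P * Q)" unfolding AP[symmetric] using c by (intro assoc_mult_mat)
  then have "?A = P * ?B * Q" using PQ c by simp
  then show ?thesis
    using PQ c by (intro similar_matI[of _ _ P Q n]) auto
qed

lemma laplacian_spectrum_eq:
  assumes "distinct vs" "set vs = verts G"
  shows "laplacian_spectrum G = proots (char_poly (laplacian_matrix G vs))"
proof -
  define ws where "ws = (SOME vs. distinct vs \<and> set vs = verts G)"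
  have "distinct ws \<and> set ws = verts G" unfolding ws_def by (rule someI_ex) (use assms in blast)
  then have "similar_mat (laplacian_matrix G ws) (laplacian_matrix G vs)"
    using assms by (intro laplacian_matrix_similar) auto
  from char_poly_similar[OF this] show ?thesis by (simp add: laplacian_spectrum_def ws_def)
qed

lemma real_symmetric_size_proots_char_poly:
  fixes A :: "real mat"
  assumes A: "A \<in> carrier_mat n n"
    and sym: "\<And>i j. i < n \<Longrightarrow> j < n \<Longrightarrow> A $$ (i, j) = A $$ (j, i)"
  shows "size (proots (char_poly A)) = n"
proof -
  define M :: "complex mat" where "M = map_mat of_real A"
  have M: "M \<in> carrier_mat n n" using A by (simp add: M_def)
  have cM: "char_poly M = map_poly of_real (char_poly A)"
    unfolding M_def by (rule of_real_hom.char_poly_hom[OF A])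
  obtain as where as: "char_poly M = (\<Prod>a\<leftarrow>as. [:- a, 1:])" "length as = n"
    using char_poly_factorized[OF M] by blast
  have real: "complex_of_real (Re a) = a" if "a \<in> set as" for a
  proof -
    have "poly (char_poly M) a = 0"
      unfolding as poly_prod_list using that by (auto simp: prod_list_zero_iff image_iff)
    then have "eigenvalue M a" using eigenvalue_root_char_poly[OF M] by simp
    then obtain v where v: "v \<in> carrier_vec n" "v \<noteq> 0\<^sub>v n" "M *\<^sub>v v = a \<cdot>\<^sub>v v"
      unfolding eigenvalue_def eigenvector_def using M by auto
    have row: "(\<Sum>j<n. of_real (A $$ (i, j)) * v $ j) = a * v $ i" if i: "i < n" for i
    proof -
      have "(M *\<^sub>v v) $ i = (\<Sum>j<n. of_real (A $$ (i, j)) * v $ j)"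
        using A i v(1) by (simp add: M_def scalar_prod_def atLeast0LessThan)
      then show ?thesis using v i by simp
    qed
    define S where "S = (\<Sum>i<n. \<Sum>j<n. cnj (v $ i) * (of_real (A $$ (i, j)) * v $ j))"
    define N where "N = (\<Sum>i<n. (cmod (v $ i))\<^sup>2)"
    have "S = (\<Sum>i<n. cnj (v $ i) * (a * v $ i))"
      unfolding S_def by (intro sum.cong) (simp_all add: row flip: sum_distrib_left)
    also have "\<dots> = a * of_real N"
      by (simp add: N_def sum_distrib_left complex_norm_square ac_simps del: of_real_power)
    finally have S: "S = a * of_real N" .
    have "cnj S = (\<Sum>i<n. \<Sum>j<n. v $ i * (of_real (A $$ (i, j)) * cnj (v $ j)))"
      by (simp add: S_def)
    also have "\<dots> = (\<Sum>j<n. \<Sum>i<n. v $ i * (of_real (A $$ (i, j)) * cnj (v $ j)))"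
      by (rule sum.swap)
    also have "\<dots> = S"
      unfolding S_def by (intro sum.cong refl) (simp add: sym ac_simps)
    finally have cS: "cnj S = S" .
    obtain k where k: "k < n" "v $ k \<noteq> 0"
      using v by (metis eq_vecI carrier_vecD index_zero_vec)
    have "0 < (cmod (v $ k))\<^sup>2" using k by simp
    also have "\<dots> \<le> N" unfolding N_def using k by (intro member_le_sum) auto
    finally have "N \<noteq> 0" by simp
    with cS S have "cnj a = a" by simp
    then show ?thesis by (metis Reals_cnj_iff of_real_Re)
  qed
  interpret mp: map_poly_comm_ring_hom "of_real :: real \<Rightarrow> complex" ..
  define bs where "bs = map Re as"
  have "map complex_of_real bs = as" unfolding bs_def by (simp add: real map_idI)
  then have "map_poly complex_of_real (char_poly A) =
      (\<Prod>a\<leftarrow>map complex_of_real bs. [:- a, 1:])"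
    using cM as(1) by simp
  also have "\<dots> = map_poly complex_of_real (\<Prod>b\<leftarrow>bs. [:- b, 1:])"
    by (induction bs) (simp_all add: mp.hom_mult del: mult_pCons_left)
  finally have cA: "char_poly A = (\<Prod>b\<leftarrow>bs. [:- b, 1:])"
    by (simp add: poly_eq_iff coeff_map_poly)
  have nz: "(\<Prod>b\<leftarrow>cs. [:- b, 1:]) \<noteq> 0" for cs :: "real list"
    by (auto simp: prod_list_zero_iff)
  have "size (proots (\<Prod>b\<leftarrow>bs. [:- b, 1:])) = length bs"
  proof (induction bs)
    case (Cons a bs)
    have "proots ([:- a, 1:] * (\<Prod>b\<leftarrow>bs. [:- b, 1:])) =
        proots [:- a, 1:] + proots (\<Prod>b\<leftarrow>bs. [:- b, 1:])"
      by (rule proots_mult[OF _ nz]) simp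
    also have "proots [:- a, 1:] = {#a#}" by (subst proots_linear_factor) simp
    finally show ?case using Cons by (simp del: mult_pCons_left)
  qed simp
  then show ?thesis using as(2) cA by (simp add: bs_def)
qed

lemma size_laplacian_spectrum:
  assumes "graph G"
  shows "size (laplacian_spectrum G) = card (verts G)"
proof -
  interpret graph G by fact
  obtain vs where vs: "set vs = verts G" "distinct vs"
    using finite_distinct_list[OF finite_verts] by blast
  have "size (proots (char_poly (laplacian_matrix G vs))) = length vs"
  proof (rule real_symmetric_size_proots_char_poly)
    fix i j assume "i < length vs" "j < length vs"
    moreover have "vs ! i \<rightarrow>\<^bsub>G\<^esub> vs ! j \<longleftrightarrow> vs ! j \<rightarrow>\<^bsub>G\<^esub> vs ! i"
      by (auto intro: arcs_ends_symmetric)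
    ultimately show "laplacian_matrix G vs $$ (i, j) = laplacian_matrix G vs $$ (j, i)"
      by (auto simp: laplacian_matrix_index)
  qed simp
  then show ?thesis using vs by (simp add: laplacian_spectrum_eq distinct_card[symmetric])
qed

end

theory Submission
  imports Defs "Jordan_Normal_Form.Schur_Decomposition" "HOL-Analysis.Convex"
begin

text \<open>
  Orient every edge that meets \<open>U\<close> so that the edges between \<open>U\<close> and its complement leave \<open>U\<close> and every
  vertex of \<open>U\<close> has at least one outgoing edge. Connectivity makes this possible: rank the vertices of
  \<open>U\<close> such that each has a neighbour of lower rank or outside \<open>U\<close>, and orient towards the lower rank
  (\<open>exists_ranking_towards_complement\<close>). Let \<open>d u > 0\<close> be the number of edges leaving \<open>u\<close>. Each edge
  inside \<open>U\<close> is lost at exactly one of its ends, so the \<open>d u\<close> sum to the sum of the degrees over \<open>U\<close>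
  minus the number of edges inside \<open>U\<close>.

  The Laplacian is \<open>Q Q\<^sup>T\<close> for the oriented incidence matrix \<open>Q\<close>. In edge space, the \<open>card U\<close> unit
  vectors that are constant on the edges leaving one \<open>u\<close>, together with a unit top eigenvector for the
  edges inside the complement of \<open>U\<close>, have disjoint supports and are thus orthonormal. Their images
  under \<open>Q\<close> have squared norms \<open>d u + 1\<close> and \<open>\<theta>\<close>, where \<open>\<theta>\<close> is the largest Laplacian eigenvalue of
  the subgraph induced by the complement. (If \<open>\<theta> = 0\<close>, the zero vector replaces the eigenvector.) The
  sum of these squared norms is the right-hand side of the claim, and it is at most the sum of the
  \<open>card U + 1\<close> largest eigenvalues of \<open>Q Q\<^sup>T\<close>.

  The argument below works with the images \<open>y j\<close> in vertex space. The orthonormal vectors enter through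
  Bessel's inequality, \<open>(\<Sum>j. \<langle>y j, g\<rangle>\<^sup>2) \<le> \<langle>g, L g\<rangle>\<close> for every \<open>g\<close>. It follows
  from the Cauchy-Schwarz inequality on each part of the edge set (\<open>dirichlet_form_split\<close>). The bound by
  the largest eigenvalues is a variant of Ky Fan's maximum principle
  (\<open>sum_norms_le_sum_top_eigenvalues\<close>), which rests on the spectral theorem for real symmetric matrices
  (\<open>real_symmetric_sorted_eigenbasis\<close>).
\<close>

(* Two inner products share the symbol \<bullet>; here it is the scalar product of coordinate vectors. *)
unbundle no inner_syntax

section \<open>Orthonormal eigenbases of real symmetric matrices\<close>

lemma monic_eq_prod_proots:
  fixes p :: "'a :: idom poly"
  assumes "size (proots p) = degree p" "lead_coeff p = 1"
  shows "p = (\<Prod>x\<in>#proots p. [:- x, 1:])"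
  using assms
proof (induction "degree p" arbitrary: p)
  case 0
  then have "proots p = {#}" by simp
  moreover from 0 have "p = 1" by (metis degree_0_id one_pCons)
  ultimately show ?case by simp
next
  case (Suc d)
  have p0: "p \<noteq> 0" using Suc.hyps(2) by auto
  have "proots p \<noteq> {#}" using Suc by auto
  then obtain x where "x \<in># proots p" by blast
  then have "poly p x = 0" using p0 by simp
  then obtain q where q: "p = [:- x, 1:] * q" by (metis poly_eq_0_iff_dvd dvdE)
  have q0: "q \<noteq> 0" using p0 q by auto
  have pr: "proots p = {#x#} + proots q"
    unfolding q using q0 by (subst proots_mult) auto
  have dg: "degree p = Suc (degree q)" unfolding q using q0 by (subst degree_mult_eq) auto
  have lc: "lead_coeff q = 1"
    using Suc.prems(2) unfolding q lead_coeff_mult by simp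
  have "q = (\<Prod>x\<in>#proots q. [:- x, 1:])"
    using Suc pr dg lc by (intro Suc.hyps(1)) auto
  then have "[:- x, 1:] * q = [:- x, 1:] * (\<Prod>y\<in>#proots q. [:- y, 1:])" by (rule arg_cong)
  then show ?case unfolding pr using q by (simp del: mult_pCons_left)
qed

lemma trace_mult_commute:
  fixes A B :: "'a :: comm_semiring_0 mat"
  assumes "A \<in> carrier_mat n m" "B \<in> carrier_mat m n"
  shows "(\<Sum>i<n. (A * B) $$ (i, i)) = (\<Sum>i<m. (B * A) $$ (i, i))"
proof -
  have "(\<Sum>i<n. (A * B) $$ (i, i)) = (\<Sum>i<n. \<Sum>j<m. A $$ (i, j) * B $$ (j, i))"
    using assms by (intro sum.cong) (auto simp: scalar_prod_def atLeast0LessThan)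
  also have "\<dots> = (\<Sum>j<m. \<Sum>i<n. B $$ (j, i) * A $$ (i, j))"
    by (subst sum.swap) (simp add: mult.commute)
  also have "\<dots> = (\<Sum>j<m. (B * A) $$ (j, j))"
    using assms by (intro sum.cong) (auto simp: scalar_prod_def atLeast0LessThan)
  finally show ?thesis .
qed

text \<open>
  Triangularize: \<open>A = P B Q\<close> with \<open>Q P = 1\<close> and the \<open>es\<close> on the diagonal of \<open>B\<close>, and a trace does not
  change under cyclic permutation of the factors.
\<close>

lemma trace_eq_sum_roots:
  fixes A :: "real mat"
  assumes A: "A \<in> carrier_mat n n" and c: "char_poly A = (\<Prod>e\<leftarrow>es. [:- e, 1:])"
  shows "(\<Sum>i<n. A $$ (i, i)) = sum_list es"
proof -
  obtain B P Q where s: "schur_decomposition A es = (B, P, Q)"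
    by (cases "schur_decomposition A es") auto
  from schur_decomposition[OF A c s] have w: "similar_mat_wit A B P Q" and d: "diag_mat B = es"
    by auto
  note w = similar_mat_witD2[OF A w]
  have "(\<Sum>i<n. A $$ (i, i)) = (\<Sum>i<n. (P * (B * Q)) $$ (i, i))"
    using w by (simp add: assoc_mult_mat[of P n n B n Q n])
  also have "\<dots> = (\<Sum>i<n. (B * Q * P) $$ (i, i))"
    using w by (intro trace_mult_commute) auto
  also have "B * Q * P = B" using w by (simp add: assoc_mult_mat[of B n n Q n P n])
  also have "(\<Sum>i<n. B $$ (i, i)) = sum_list (diag_mat B)"
    using w by (simp add: diag_mat_def sum_list_sum_nth atLeast0LessThan)
  finally show ?thesis using d by simp
qed

text \<open>
  A symmetric matrix has \<open>n\<close> real eigenvalues and they sum to the trace, so they cannot all equal \<open>c\<close>.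
  This is how an eigenvector outside a given eigenspace is found below.
\<close>

lemma real_symmetric_eigenvalue_neq:
  fixes A :: "real mat"
  assumes A: "A \<in> carrier_mat n n"
    and sym: "\<And>i j. i < n \<Longrightarrow> j < n \<Longrightarrow> A $$ (i, j) = A $$ (j, i)"
    and tr: "(\<Sum>i<n. A $$ (i, i)) \<noteq> real n * c"
  shows "\<exists>e. eigenvalue A e \<and> e \<noteq> c"
proof (rule ccontr)
  assume neg: "\<not> ?thesis"
  note dg = degree_monic_char_poly[OF A]
  obtain es where es: "mset es = proots (char_poly A)" using ex_mset by blast
  have sz: "size (proots (char_poly A)) = n"
    by (rule real_symmetric_size_proots_char_poly[OF A sym])
  have "char_poly A = (\<Prod>x\<in>#proots (char_poly A). [:- x, 1:])"
    using dg sz by (intro monic_eq_prod_proots) auto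
  also have "\<dots> = (\<Prod>e\<leftarrow>es. [:- e, 1:])" by (simp add: es[symmetric] prod_mset_prod_list[symmetric])
  finally have c: "char_poly A = (\<Prod>e\<leftarrow>es. [:- e, 1:])" .
  have p0: "char_poly A \<noteq> 0" using dg by auto
  have "e = c" if "e \<in> set es" for e
  proof -
    have "e \<in># proots (char_poly A)" using that es by (metis set_mset_mset)
    then show ?thesis using neg p0 eigenvalue_root_char_poly[OF A] by auto
  qed
  then have "es = replicate (length es) c" by (simp add: replicate_eqI)
  moreover have "length es = n" using sz es by (metis size_mset)
  ultimately have "sum_list es = real n * c" by (metis sum_list_replicate)
  then show False using tr trace_eq_sum_roots[OF A c] by simp
qed

lemma symmetric_scalar_prod:
  fixes A :: "'a :: comm_semiring_0 mat"
  assumes A: "A \<in> carrier_mat n n"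
    and sym: "\<And>i j. i < n \<Longrightarrow> j < n \<Longrightarrow> A $$ (i, j) = A $$ (j, i)"
    and x: "x \<in> carrier_vec n" and y: "y \<in> carrier_vec n"
  shows "(A *\<^sub>v x) \<bullet> y = x \<bullet> (A *\<^sub>v y)"
proof -
  have "transpose_mat A = A" using A by (intro eq_matI) (auto simp: sym)
  then show ?thesis using transpose_vec_mult_scalar[OF A y x] by simp
qed

lemma scalar_prod_self_pos:
  fixes v :: "real vec"
  assumes "v \<in> carrier_vec n" "v \<noteq> 0\<^sub>v n"
  shows "v \<bullet> v > 0"
proof -
  obtain k where k: "k < n" "v $ k \<noteq> 0"
    using assms by (metis eq_vecI carrier_vecD index_zero_vec)
  have "0 < v $ k * v $ k" using k by (auto simp: zero_less_mult_iff)
  also have "\<dots> \<le> v \<bullet> v"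
    unfolding scalar_prod_def using k assms by (intro member_le_sum) auto
  finally show ?thesis .
qed

text \<open>
  An orthonormal family of \<open>k < n\<close> eigenvectors is extended by deflation. Replacing the eigenvalue
  of each known eigenvector by a common value \<open>c\<close> gives a symmetric matrix \<open>A'\<close>; for a suitable \<open>c\<close> its
  trace is not \<open>n c\<close>, so \<open>A'\<close> has an eigenvalue other than \<open>c\<close>. An eigenvector for it is orthogonal
  to the known ones, on which \<open>A'\<close> acts as \<open>c\<close>, and there \<open>A\<close> and \<open>A'\<close> agree.
\<close>

lemma orthonormal_eigenvectors:
  fixes A :: "real mat"
  assumes A: "A \<in> carrier_mat n n"
    and sym: "\<And>i j. i < n \<Longrightarrow> j < n \<Longrightarrow> A $$ (i, j) = A $$ (j, i)"
  shows "k \<le> n \<Longrightarrow> \<exists>v \<mu>. (\<forall>i<k. v i \<in> carrier_vec n \<and> A *\<^sub>v v i = \<mu> i \<cdot>\<^sub>v v i) \<and>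
    (\<forall>i<k. \<forall>j<k. v i \<bullet> v j = (if i = j then 1 else 0))"
proof (induction k)
  case 0
  then show ?case by simp
next
  case (Suc k)
  then obtain v :: "nat \<Rightarrow> real vec" and \<mu> where
    v: "\<And>i. i < k \<Longrightarrow> v i \<in> carrier_vec n" "\<And>i. i < k \<Longrightarrow> A *\<^sub>v v i = \<mu> i \<cdot>\<^sub>v v i"
    and on: "\<And>i j. i < k \<Longrightarrow> j < k \<Longrightarrow> v i \<bullet> v j = (if i = j then 1 else 0)"
    using Suc_leD[of k n] by blast
  define tA where "tA = (\<Sum>i<n. A $$ (i, i))"
  \<comment> \<open>All eigenvalues of \<open>A'\<close> can equal \<open>c\<close> only if \<open>c\<close> is the quotient below; hence the added 1.\<close>
  define c where "c = (tA - (\<Sum>l<k. \<mu> l)) / (real n - real k) + 1"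
  define A' where
    "A' = mat n n (\<lambda>(i, j). A $$ (i, j) + (\<Sum>l<k. (c - \<mu> l) * (v l $ i * v l $ j)))"
  have A': "A' \<in> carrier_mat n n" by (simp add: A'_def)
  have sym': "A' $$ (i, j) = A' $$ (j, i)" if "i < n" "j < n" for i j
    using that by (simp add: A'_def sym mult.commute)
  have "(\<Sum>i<n. A' $$ (i, i)) = tA + (\<Sum>l<k. (c - \<mu> l) * (v l \<bullet> v l))"
  proof -
    have "(\<Sum>i<n. A' $$ (i, i)) = tA + (\<Sum>i<n. \<Sum>l<k. (c - \<mu> l) * (v l $ i * v l $ i))"
      by (simp add: A'_def tA_def sum.distrib)
    also have "(\<Sum>i<n. \<Sum>l<k. (c - \<mu> l) * (v l $ i * v l $ i)) = (\<Sum>l<k. (c - \<mu> l) * (v l \<bullet> v l))"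
      by (subst sum.swap, intro sum.cong)
        (auto simp: scalar_prod_def sum_distrib_left atLeast0LessThan dest: v(1))
    finally show ?thesis .
  qed
  also have "\<dots> = tA + real k * c - (\<Sum>l<k. \<mu> l)" by (simp add: on sum_subtractf)
  also have "\<dots> = real n * c - (real n - real k)"
  proof -
    have "real n - real k \<noteq> 0" using Suc.prems by simp
    then have "tA - (\<Sum>l<k. \<mu> l) = (real n - real k) * (c - 1)" by (simp add: c_def)
    then show ?thesis by (simp add: algebra_simps)
  qed
  finally have "(\<Sum>i<n. A' $$ (i, i)) \<noteq> real n * c" using Suc.prems by simp
  then obtain e where e: "eigenvalue A' e" "e \<noteq> c"
    using real_symmetric_eigenvalue_neq[OF A' sym'] by blast
  then obtain w0 where w0: "w0 \<in> carrier_vec n" "w0 \<noteq> 0\<^sub>v n" "A' *\<^sub>v w0 = e \<cdot>\<^sub>v w0"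
    unfolding eigenvalue_def eigenvector_def using A' by auto
  have A'x: "(A' *\<^sub>v x) $ i = (A *\<^sub>v x) $ i + (\<Sum>l<k. (c - \<mu> l) * (v l \<bullet> x) * v l $ i)"
    if x: "x \<in> carrier_vec n" and i: "i < n" for x i
  proof -
    have "(A' *\<^sub>v x) $ i =
        (\<Sum>j<n. A $$ (i, j) * x $ j) + (\<Sum>j<n. \<Sum>l<k. (c - \<mu> l) * (v l $ i * v l $ j) * x $ j)"
      using x i by (simp add: A'_def scalar_prod_def atLeast0LessThan ring_distribs
          sum.distrib sum_distrib_right)
    also have "(\<Sum>j<n. A $$ (i, j) * x $ j) = (A *\<^sub>v x) $ i"
      using x i A by (simp add: scalar_prod_def atLeast0LessThan)
    also have "(\<Sum>j<n. \<Sum>l<k. (c - \<mu> l) * (v l $ i * v l $ j) * x $ j) =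
        (\<Sum>l<k. (c - \<mu> l) * (v l \<bullet> x) * v l $ i)"
      using x by (subst sum.swap, intro sum.cong)
        (auto simp: scalar_prod_def sum_distrib_left sum_distrib_right atLeast0LessThan mult_ac
          intro!: sum.cong)
    finally show ?thesis .
  qed
  have A'v: "A' *\<^sub>v v m = c \<cdot>\<^sub>v v m" if m: "m < k" for m
  proof (rule eq_vecI)
    fix i assume "i < dim_vec (c \<cdot>\<^sub>v v m)"
    then have i: "i < n" using v(1)[OF m] by simp
    have "(\<Sum>l<k. (c - \<mu> l) * (v l \<bullet> v m) * v l $ i) =
        (\<Sum>l<k. if l = m then (c - \<mu> m) * v m $ i else 0)"
      using m by (intro sum.cong) (auto simp: on)
    then show "(A' *\<^sub>v v m) $ i = (c \<cdot>\<^sub>v v m) $ i"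
      using m i v(1)[OF m] by (simp add: A'x v(2) algebra_simps)
  qed (use A' v(1)[OF m] in auto)
  have orth0: "v m \<bullet> w0 = 0" if m: "m < k" for m
  proof -
    have "e * (v m \<bullet> w0) = v m \<bullet> (A' *\<^sub>v w0)" using w0 v(1)[OF m] by simp
    also have "\<dots> = (A' *\<^sub>v v m) \<bullet> w0"
      using symmetric_scalar_prod[OF A' sym' v(1)[OF m] w0(1)] by simp
    also have "\<dots> = c * (v m \<bullet> w0)" using w0 v(1)[OF m] by (simp add: A'v[OF m])
    finally show ?thesis using e by simp
  qed
  have Aw0: "A *\<^sub>v w0 = e \<cdot>\<^sub>v w0"
  proof (rule eq_vecI)
    fix i assume "i < dim_vec (e \<cdot>\<^sub>v w0)"
    then have i: "i < n" using w0 by simp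
    show "(A *\<^sub>v w0) $ i = (e \<cdot>\<^sub>v w0) $ i"
      using A'x[OF w0(1) i] w0 by (simp add: orth0)
  qed (use A w0 in auto)
  define w where "w = (1 / sqrt (w0 \<bullet> w0)) \<cdot>\<^sub>v w0"
  have pos: "w0 \<bullet> w0 > 0" using w0 by (intro scalar_prod_self_pos)
  have w: "w \<in> carrier_vec n" "w \<bullet> w = 1" "A *\<^sub>v w = e \<cdot>\<^sub>v w"
    using w0 pos A by (auto simp: w_def Aw0 mult_mat_vec smult_smult_assoc mult.commute)
  have orth: "v m \<bullet> w = 0" "w \<bullet> v m = 0" if "m < k" for m
    using orth0[OF that] w0 v(1)[OF that] comm_scalar_prod[OF w0(1) v(1)[OF that]]
    by (auto simp: w_def)
  show ?case
    by (rule exI[of _ "v(k := w)"], rule exI[of _ "\<mu>(k := e)"])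
      (use v on w orth in \<open>auto simp: less_Suc_eq\<close>)
qed

text \<open>
  The matrix with rows \<open>v i\<close> has orthonormal rows; being square, it also has orthonormal columns.
\<close>

lemma orthonormal_basis_parseval:
  fixes v :: "nat \<Rightarrow> real vec"
  assumes v: "\<And>i. i < n \<Longrightarrow> v i \<in> carrier_vec n"
    and on: "\<And>i j. i < n \<Longrightarrow> j < n \<Longrightarrow> v i \<bullet> v j = (if i = j then 1 else 0)"
    and x: "x \<in> carrier_vec n" and y: "y \<in> carrier_vec n"
  shows "(\<Sum>i<n. (v i \<bullet> x) * (v i \<bullet> y)) = x \<bullet> y"
proof -
  define R where "R = mat n n (\<lambda>(i, j). v i $ j)"
  have R: "R \<in> carrier_mat n n" by (simp add: R_def)
  have row: "row R i = v i" if "i < n" for i using v[OF that] that by (auto simp: R_def)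
  have "R * transpose_mat R = 1\<^sub>m n"
    by (rule eq_matI) (use R in \<open>auto simp: row on\<close>)
  then have RR: "transpose_mat R * R = 1\<^sub>m n"
    using mat_mult_left_right_inverse[OF R] R by simp
  have Rx: "R *\<^sub>v z = vec n (\<lambda>i. v i \<bullet> z)" for z
    using R by (auto simp: row)
  have "(\<Sum>i<n. (v i \<bullet> x) * (v i \<bullet> y)) = (R *\<^sub>v x) \<bullet> (R *\<^sub>v y)"
    by (simp add: Rx scalar_prod_def[of "vec n _"] atLeast0LessThan)
  also have "\<dots> = (transpose_mat R *\<^sub>v (R *\<^sub>v x)) \<bullet> y"
    using R x y by (subst transpose_vec_mult_scalar[OF R]) auto
  also have "transpose_mat R *\<^sub>v (R *\<^sub>v x) = x"
    using R x by (simp add: RR flip: assoc_mult_mat_vec[of _ n n _ n])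
  finally show ?thesis .
qed

lemma proots_prod_linear_factors:
  fixes bs :: "'a :: idom list"
  shows "proots (\<Prod>b\<leftarrow>bs. [:- b, 1:]) = mset bs"
proof (induction bs)
  case (Cons b bs)
  have nz: "(\<Prod>b\<leftarrow>bs. [:- b, 1:]) \<noteq> 0" by (auto simp: prod_list_zero_iff)
  have "proots ([:- b, 1:] * (\<Prod>b\<leftarrow>bs. [:- b, 1:])) =
      proots [:- b, 1:] + proots (\<Prod>b\<leftarrow>bs. [:- b, 1:])"
    by (rule proots_mult[OF _ nz]) simp
  then show ?case using Cons by (simp del: mult_pCons_left)
qed simp

text \<open>
  This ties an eigenbasis, whose order and multiplicities are arbitrary, to the multiset of roots of the
  characteristic polynomial: the matrix is similar to the diagonal matrix of the \<open>\<mu> i\<close>.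
\<close>

lemma proots_char_poly_eq_eigenbasis:
  fixes A :: "real mat"
  assumes A: "A \<in> carrier_mat n n"
    and v: "\<And>i. i < n \<Longrightarrow> v i \<in> carrier_vec n" "\<And>i. i < n \<Longrightarrow> A *\<^sub>v v i = \<mu> i \<cdot>\<^sub>v v i"
    and on: "\<And>i j. i < n \<Longrightarrow> j < n \<Longrightarrow> v i \<bullet> v j = (if i = j then 1 else 0)"
  shows "proots (char_poly A) = mset (map \<mu> [0..<n])"
proof -
  define R where "R = mat n n (\<lambda>(i, j). v i $ j)"
  define P where "P = transpose_mat R"
  define D where "D = mat n n (\<lambda>(i, j). if i = j then \<mu> i else 0)"
  have c: "R \<in> carrier_mat n n" "P \<in> carrier_mat n n" "D \<in> carrier_mat n n"
    by (auto simp: R_def P_def D_def)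
  have row: "row R i = v i" if "i < n" for i using v(1)[OF that] that by (auto simp: R_def)
  have col: "col P i = v i" if "i < n" for i using row that c by (simp add: P_def)
  have RP: "R * P = 1\<^sub>m n"
    by (rule eq_matI) (use c in \<open>auto simp: row col on\<close>)
  then have PR: "P * R = 1\<^sub>m n" using mat_mult_left_right_inverse c by blast
  have "A * P = P * D"
  proof (rule eq_matI)
    fix i j assume "i < dim_row (P * D)" "j < dim_col (P * D)"
    then have ij: "i < n" "j < n" using c by auto
    have "(A * P) $$ (i, j) = (A *\<^sub>v v j) $ i" using ij c A by (simp add: col)
    also have "\<dots> = v j $ i * \<mu> j" using ij v(1)[of j] by (simp add: v(2))
    also have "\<dots> = (\<Sum>l = 0..<n. if l = j then v j $ i * \<mu> j else 0)" using ij by simp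
    also have "\<dots> = (P * D) $$ (i, j)"
      using ij c by (simp add: scalar_prod_def P_def R_def D_def if_distrib cong: if_cong)
    finally show "(A * P) $$ (i, j) = (P * D) $$ (i, j)" .
  qed (use c A in auto)
  then have "P * D * R = A * (P * R)" using assoc_mult_mat[OF A c(2) c(1)] by simp
  then have "A = P * D * R" using A by (simp add: PR)
  then have "similar_mat A D"
    using RP PR c A by (intro similar_matI[of _ _ P R n]) auto
  then have "char_poly A = char_poly D" by (rule char_poly_similar)
  also have "\<dots> = (\<Prod>a\<leftarrow>diag_mat D. [:- a, 1:])"
    using c by (intro char_poly_upper_triangular) (auto simp: D_def)
  also have "diag_mat D = map \<mu> [0..<n]" by (auto simp: diag_mat_def D_def)
  finally show ?thesis by (simp only: proots_prod_linear_factors)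
qed

lemma real_symmetric_sorted_eigenbasis:
  fixes A :: "real mat"
  assumes A: "A \<in> carrier_mat n n"
    and sym: "\<And>i j. i < n \<Longrightarrow> j < n \<Longrightarrow> A $$ (i, j) = A $$ (j, i)"
  defines "es \<equiv> rev (sorted_list_of_multiset (proots (char_poly A)))"
  obtains v where "\<And>i. i < n \<Longrightarrow> v i \<in> carrier_vec n"
    "\<And>i. i < n \<Longrightarrow> A *\<^sub>v v i = es ! i \<cdot>\<^sub>v v i"
    "\<And>i j. i < n \<Longrightarrow> j < n \<Longrightarrow> v i \<bullet> v j = (if i = j then 1 else 0)"
proof -
  obtain u :: "nat \<Rightarrow> real vec" and \<mu> where
    u: "\<And>i. i < n \<Longrightarrow> u i \<in> carrier_vec n" "\<And>i. i < n \<Longrightarrow> A *\<^sub>v u i = \<mu> i \<cdot>\<^sub>v u i"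
    and on: "\<And>i j. i < n \<Longrightarrow> j < n \<Longrightarrow> u i \<bullet> u j = (if i = j then 1 else 0)"
    using orthonormal_eigenvectors[OF A sym order_refl] by blast
  \<comment> \<open>The eigenvectors are reordered by sorting their indices along the eigenvalues.\<close>
  define idx where "idx = rev (sort_key \<mu> [0..<n])"
  have "sort (map \<mu> [0..<n]) = map \<mu> (sort_key \<mu> [0..<n])"
    by (rule properties_for_sort) simp_all
  moreover have "proots (char_poly A) = mset (map \<mu> [0..<n])"
    by (rule proots_char_poly_eq_eigenbasis[where v = u]) (use A u on in auto)
  ultimately have es: "es = map \<mu> idx"
    unfolding es_def idx_def by (simp only: sorted_list_of_multiset_mset rev_map)
  have idx: "length idx = n" "distinct idx" "set idx = {0..<n}" by (auto simp: idx_def)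
  then have lt: "idx ! i < n" if "i < n" for i
    using that nth_mem[of i idx] by auto
  show thesis
  proof (rule that[of "\<lambda>i. u (idx ! i)"])
    show "u (idx ! i) \<bullet> u (idx ! j) = (if i = j then 1 else 0)" if "i < n" "j < n" for i j
      using that idx by (simp add: on lt nth_eq_iff_index_eq)
  qed (use idx in \<open>auto simp: u lt es\<close>)
qed

section \<open>A maximum principle for sums of eigenvalues\<close>

text \<open>
  Weights between 0 and 1 with total at most \<open>k\<close> do best when concentrated on the \<open>k\<close> largest values.
  Subtract the \<open>k\<close>-th value \<open>\<mu>\<close>: then the terms before \<open>k\<close> are nonnegative and the later ones nonpositive.
\<close>

lemma sum_weighted_le_sum_initial:
  fixes a c :: "nat \<Rightarrow> real"
  assumes anti: "\<And>i j. i \<le> j \<Longrightarrow> j < n \<Longrightarrow> a j \<le> a i"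
    and nonneg: "\<And>i. i < n \<Longrightarrow> 0 \<le> a i"
    and c: "\<And>i. i < n \<Longrightarrow> 0 \<le> c i" "\<And>i. i < n \<Longrightarrow> c i \<le> 1"
    and k: "(\<Sum>i<n. c i) \<le> real k" "k \<le> n"
  shows "(\<Sum>i<n. a i * c i) \<le> (\<Sum>i<k. a i)"
proof (cases k)
  case 0
  have "(\<Sum>i<n. c i) = 0" using k 0 c by (intro antisym sum_nonneg) auto
  then have "\<forall>i\<in>{..<n}. c i = 0" using c by (subst (asm) sum_nonneg_eq_0_iff) auto
  then show ?thesis using 0 by simp
next
  case (Suc k')
  define \<mu> where "\<mu> = a k'"
  have \<mu>: "\<mu> \<ge> 0" unfolding \<mu>_def using nonneg k Suc by auto
  have "(a i - \<mu>) * c i \<le> (if i < k then a i - \<mu> else 0)" if i: "i < n" for i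
  proof (cases "i < k")
    case True
    then have "a i - \<mu> \<ge> 0" unfolding \<mu>_def using anti[of i k'] k Suc by auto
    then show ?thesis using True c(2)[OF i] mult_left_le[of "c i" "a i - \<mu>"] by simp
  next
    case False
    then have "a i - \<mu> \<le> 0" unfolding \<mu>_def using anti[of k' i] i Suc by auto
    then show ?thesis using False c(1)[OF i] by (simp add: mult_nonpos_nonneg)
  qed
  then have "(\<Sum>i<n. (a i - \<mu>) * c i) \<le> (\<Sum>i<n. if i < k then a i - \<mu> else 0)"
    by (intro sum_mono) auto
  also have "\<dots> = (\<Sum>i\<in>{..<n} \<inter> {i. i < k}. a i - \<mu>)" by (simp add: sum.inter_restrict)
  also have "{..<n} \<inter> {i. i < k} = {..<k}" using k by auto
  finally have "(\<Sum>i<n. a i * c i) - \<mu> * (\<Sum>i<n. c i) \<le> (\<Sum>i<k. a i) - \<mu> * real k"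
    by (simp add: sum_subtractf sum_distrib_left algebra_simps)
  moreover have "\<mu> * (\<Sum>i<n. c i) \<le> \<mu> * real k" using k \<mu> by (intro mult_left_mono)
  ultimately show ?thesis by linarith
qed

text \<open>
  The hypothesis says that \<open>\<Sum>j. y j (y j)\<^sup>T\<close>, a positive semidefinite matrix of rank at most \<open>card J\<close>,
  lies below \<open>A\<close> in the semidefinite order; the conclusion bounds its trace.

  Expand everything in an orthonormal eigenbasis \<open>v i\<close> of \<open>A\<close> with eigenvalues \<open>\<mu> i\<close>. The trace is
  \<open>\<Sum>i. \<mu> i * c i\<close> with weights \<open>c i = (\<Sum>j. (v i \<bullet> y j)\<^sup>2) / \<mu> i\<close>. Testing the hypothesis with \<open>v i\<close>
  gives \<open>c i \<le> 1\<close>. Testing it with the image of \<open>y j\<close> under the pseudoinverse of \<open>A\<close> shows that each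
  \<open>j\<close> contributes at most 1 to the sum of all weights, so that they sum to at most \<open>card J\<close>.
\<close>

lemma sum_norms_le_sum_top_eigenvalues:
  fixes A :: "real mat" and y :: "'j \<Rightarrow> real vec"
  assumes A: "A \<in> carrier_mat n n"
    and sym: "\<And>i j. i < n \<Longrightarrow> j < n \<Longrightarrow> A $$ (i, j) = A $$ (j, i)"
    and J: "finite J" "card J \<le> n"
    and y: "\<And>j. j \<in> J \<Longrightarrow> y j \<in> carrier_vec n"
    and dom: "\<And>x. x \<in> carrier_vec n \<Longrightarrow> (\<Sum>j\<in>J. (y j \<bullet> x)\<^sup>2) \<le> x \<bullet> (A *\<^sub>v x)"
  shows "(\<Sum>j\<in>J. y j \<bullet> y j) \<le>
    (\<Sum>i<card J. rev (sorted_list_of_multiset (proots (char_poly A))) ! i)"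
proof -
  define es where "es = rev (sorted_list_of_multiset (proots (char_poly A)))"
  obtain v where v: "\<And>i. i < n \<Longrightarrow> v i \<in> carrier_vec n"
      "\<And>i. i < n \<Longrightarrow> A *\<^sub>v v i = es ! i \<cdot>\<^sub>v v i"
      "\<And>i j. i < n \<Longrightarrow> j < n \<Longrightarrow> v i \<bullet> v j = (if i = j then 1 else 0)"
    unfolding es_def using real_symmetric_sorted_eigenbasis[OF A sym] by blast
  have parseval: "(\<Sum>i<n. (v i \<bullet> a) * (v i \<bullet> b)) = a \<bullet> b"
    if "a \<in> carrier_vec n" "b \<in> carrier_vec n" for a b
    by (rule orthonormal_basis_parseval) (use v that in auto)
  have len: "length es = n"
    using real_symmetric_size_proots_char_poly[OF A sym]
    by (simp add: es_def) (metis mset_sorted_list_of_multiset size_mset)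
  define \<mu> where "\<mu> i = es ! i" for i
  have anti: "\<mu> j \<le> \<mu> i" if "i \<le> j" "j < n" for i j
    unfolding \<mu>_def using that len
    by (intro sorted_rev_nth_mono[of es]) (auto simp: es_def)
  define s where "s j i = v i \<bullet> y j" for j i
  define S where "S i = (\<Sum>j\<in>J. (s j i)\<^sup>2)" for i
  have S_nonneg: "S i \<ge> 0" for i unfolding S_def by (intro sum_nonneg) auto
  have S_le: "S i \<le> \<mu> i" if i: "i < n" for i
  proof -
    have "S i = (\<Sum>j\<in>J. (y j \<bullet> v i)\<^sup>2)"
      unfolding S_def s_def using comm_scalar_prod[OF y v(1)[OF i]] by (intro sum.cong) auto
    also have "\<dots> \<le> v i \<bullet> (A *\<^sub>v v i)" by (rule dom[OF v(1)[OF i]])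
    also have "\<dots> = \<mu> i" using i v(1)[OF i] by (simp add: v(2,3) \<mu>_def)
    finally show ?thesis .
  qed
  have \<mu>_nonneg: "\<mu> i \<ge> 0" if "i < n" for i using S_nonneg S_le[OF that] by (rule order_trans)
  \<comment> \<open>If \<open>\<mu> i = 0\<close>, then \<open>S i = 0\<close>, and the quotient is 0 by the convention for division by 0.\<close>
  define c where "c i = S i / \<mu> i" for i
  have \<mu>c: "\<mu> i * c i = S i" if "i < n" for i
    using S_le[OF that] S_nonneg[of i] by (simp add: c_def)
  have c01: "0 \<le> c i" "c i \<le> 1" if "i < n" for i
    using S_le[OF that] S_nonneg[of i] \<mu>_nonneg[OF that] by (auto simp: c_def divide_le_eq_1)
  have t_le: "(\<Sum>i<n. (s j i)\<^sup>2 / \<mu> i) \<le> 1" if j: "j \<in> J" for j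
  proof -
    define t where "t = (\<Sum>i<n. (s j i)\<^sup>2 / \<mu> i)"
    \<comment> \<open>\<open>x\<close> is the pseudoinverse of \<open>A\<close> applied to \<open>y j\<close>; division by 0 drops the kernel.\<close>
    define x where "x = vec n (\<lambda>a. \<Sum>i<n. s j i / \<mu> i * v i $ a)"
    have x: "x \<in> carrier_vec n" by (simp add: x_def)
    have vx: "v l \<bullet> x = s j l / \<mu> l" if l: "l < n" for l
    proof -
      have "v l \<bullet> x = (\<Sum>a<n. \<Sum>i<n. s j i / \<mu> i * (v l $ a * v i $ a))"
        by (simp add: x_def scalar_prod_def atLeast0LessThan sum_distrib_left mult_ac)
      also have "\<dots> = (\<Sum>i<n. s j i / \<mu> i * (v l \<bullet> v i))"
        by (subst sum.swap, intro sum.cong)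
          (auto simp: scalar_prod_def atLeast0LessThan sum_distrib_left dest: v(1))
      also have "\<dots> = (\<Sum>i<n. if i = l then s j l / \<mu> l else 0)"
        using l by (intro sum.cong) (auto simp: v(3))
      finally show ?thesis using l by simp
    qed
    have yx: "y j \<bullet> x = t"
      unfolding parseval[OF y[OF j] x, symmetric] t_def
      by (intro sum.cong) (auto simp: vx s_def power2_eq_square)
    have "x \<bullet> (A *\<^sub>v x) = (\<Sum>i<n. (v i \<bullet> x) * (v i \<bullet> (A *\<^sub>v x)))"
      using parseval[OF x, of "A *\<^sub>v x"] A x by simp
    also have "\<dots> = t"
      unfolding t_def
    proof (intro sum.cong refl)
      fix i assume "i \<in> {..<n}"
      then have i: "i < n" by simp
      have "v i \<bullet> (A *\<^sub>v x) = \<mu> i * (v i \<bullet> x)"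
        using symmetric_scalar_prod[OF A sym v(1)[OF i] x] i x v(1)[OF i]
        by (simp add: v(2) \<mu>_def)
      then show "(v i \<bullet> x) * (v i \<bullet> (A *\<^sub>v x)) = (s j i)\<^sup>2 / \<mu> i"
        using i by (simp add: vx power2_eq_square)
    qed
    finally have xAx: "x \<bullet> (A *\<^sub>v x) = t" .
    have "t\<^sup>2 \<le> (\<Sum>j\<in>J. (y j \<bullet> x)\<^sup>2)"
      unfolding yx[symmetric] using J j by (intro member_le_sum) auto
    also have "\<dots> \<le> t" using dom[OF x] xAx by simp
    finally have "t * t \<le> t * 1" by (simp add: power2_eq_square)
    then have "t \<le> 1" by (cases "t > 0") auto
    then show ?thesis by (simp add: t_def)
  qed
  have "(\<Sum>i<n. c i) = (\<Sum>j\<in>J. \<Sum>i<n. (s j i)\<^sup>2 / \<mu> i)"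
    unfolding c_def S_def by (subst sum.swap) (simp add: sum_divide_distrib)
  also have "\<dots> \<le> (\<Sum>j\<in>J. 1)" by (intro sum_mono t_le)
  finally have ck: "(\<Sum>i<n. c i) \<le> real (card J)" by simp
  have "(\<Sum>j\<in>J. y j \<bullet> y j) = (\<Sum>j\<in>J. \<Sum>i<n. (s j i)\<^sup>2)"
    by (intro sum.cong) (auto simp: s_def power2_eq_square parseval y)
  also have "\<dots> = (\<Sum>i<n. \<mu> i * c i)"
    by (subst sum.swap) (simp add: \<mu>c flip: S_def)
  also have "\<dots> \<le> (\<Sum>i<card J. \<mu> i)"
    by (rule sum_weighted_le_sum_initial[OF anti \<mu>_nonneg c01 ck J(2)])
  finally show ?thesis by (simp add: \<mu>_def es_def)
qed

section \<open>Ranking the vertices of a proper subset\<close>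

text \<open>
  Give rank 0 to a vertex of \<open>U\<close> that has a neighbour outside, and rank the rest of \<open>U\<close> recursively: for
  the rest, that vertex counts as outside, and it is ranked below all of them. Orienting each edge in \<open>U\<close>
  towards the lower rank, and each edge between \<open>U\<close> and its complement out of \<open>U\<close>, thus leaves every
  vertex of \<open>U\<close> with an outgoing edge.
\<close>

lemma exists_ranking_towards_complement:
  assumes "finite U" "\<And>W. W \<subseteq> U \<Longrightarrow> W \<noteq> {} \<Longrightarrow> \<exists>w\<in>W. \<exists>x. x \<notin> W \<and> R w x"
  shows "\<exists>\<rho> :: 'a \<Rightarrow> nat. inj_on \<rho> U \<and> (\<forall>u\<in>U. \<exists>w. R u w \<and> (w \<notin> U \<or> \<rho> w < \<rho> u))"
  using assms
proof (induction U rule: finite_psubset_induct)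
  case (psubset U)
  show ?case
  proof (cases "U = {}")
    case False
    then obtain u x where u: "u \<in> U" "x \<notin> U" "R u x" using psubset.prems[of U] by auto
    have "\<exists>\<rho> :: 'a \<Rightarrow> nat. inj_on \<rho> (U - {u}) \<and>
        (\<forall>v\<in>U - {u}. \<exists>w. R v w \<and> (w \<notin> U - {u} \<or> \<rho> w < \<rho> v))"
      using u psubset.prems by (intro psubset.IH) auto
    then obtain \<rho> :: "'a \<Rightarrow> nat" where \<rho>: "inj_on \<rho> (U - {u})"
        "\<And>v. v \<in> U - {u} \<Longrightarrow> \<exists>w. R v w \<and> (w \<notin> U - {u} \<or> \<rho> w < \<rho> v)" by blast
    define \<sigma> where "\<sigma> y = (if y = u then 0 else Suc (\<rho> y))" for y
    have "inj_on \<sigma> U" using \<rho>(1) by (auto simp: inj_on_def \<sigma>_def)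
    moreover have "\<exists>w. R v w \<and> (w \<notin> U \<or> \<sigma> w < \<sigma> v)" if v: "v \<in> U" for v
    proof (cases "v = u")
      case True
      then show ?thesis using u by blast
    next
      case False
      then obtain w where "R v w" "w \<notin> U - {u} \<or> \<rho> w < \<rho> v" using \<rho>(2)[of v] v by blast
      then show ?thesis using False by (intro exI[of _ w]) (auto simp: \<sigma>_def)
    qed
    ultimately show ?thesis by blast
  qed auto
qed

lemma (in graph) connected_arc_leaving:
  assumes "Digraph_Component.connected G" "W \<subseteq> verts G" "W \<noteq> {}" "W \<noteq> verts G"
  shows "\<exists>w\<in>W. \<exists>x. x \<notin> W \<and> w \<rightarrow>\<^bsub>G\<^esub> x"
proof -
  obtain w y where wy: "w \<in> W" "y \<in> verts G" "y \<notin> W" using assms by blast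
  have "strongly_connected G"
    using assms(1) sym_arcs by (intro symmetric_connected_imp_strongly_connected)
  then have "w \<rightarrow>\<^sup>*\<^bsub>G\<^esub> y" using wy assms(2) by (auto simp: strongly_connected_def)
  then show ?thesis using wy(1)
  proof (induction rule: converse_reachable_induct)
    case base
    then show ?case using wy by simp
  next
    case (step a b)
    then show ?case by blast
  qed
qed

section \<open>Neighbourhoods and induced subgraphs\<close>

lemma (in graph) dominates_sym: "u \<rightarrow>\<^bsub>G\<^esub> w \<Longrightarrow> w \<rightarrow>\<^bsub>G\<^esub> u"
  by (auto intro: arcs_ends_symmetric)

lemma (in graph) dominates_in_verts: "u \<rightarrow>\<^bsub>G\<^esub> w \<Longrightarrow> u \<in> verts G \<and> w \<in> verts G"
  by (auto simp: arcs_ends_def arc_to_ends_def)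

lemma (in graph) finite_neighbours: "finite {w. u \<rightarrow>\<^bsub>G\<^esub> w}"
  by (rule finite_subset[OF _ finite_verts]) (use dominates_in_verts in blast)

lemma (in graph) not_dominates_self: "\<not> u \<rightarrow>\<^bsub>G\<^esub> u"
  using no_loops by (auto simp: arcs_ends_def arc_to_ends_def)

lemma (in graph) finite_arcs_ends: "finite (arcs_ends G)"
  by (simp add: arcs_ends_def)

lemma (in graph) out_degree_eq_card_neighbours: "out_degree G u = card {w. u \<rightarrow>\<^bsub>G\<^esub> w}"
proof -
  have "bij_betw (head G) (out_arcs G u) {w. u \<rightarrow>\<^bsub>G\<^esub> w}"
  proof (intro bij_betw_imageI)
    show "inj_on (head G) (out_arcs G u)"
      by (auto intro!: inj_onI no_multi_arcs simp: arc_to_ends_def)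
    show "head G ` out_arcs G u = {w. u \<rightarrow>\<^bsub>G\<^esub> w}"
      by (auto simp: arcs_ends_def arc_to_ends_def)
  qed
  then show ?thesis unfolding out_degree_def by (rule bij_betw_same_card)
qed

lemma dominates_induce_subgraph_iff:
  "u \<rightarrow>\<^bsub>G \<restriction> S\<^esub> w \<longleftrightarrow> u \<rightarrow>\<^bsub>G\<^esub> w \<and> u \<in> S \<and> w \<in> S"
  by (auto simp: arcs_ends_def arc_to_ends_def)

lemma (in graph) graph_induce_subgraph:
  assumes "S \<subseteq> verts G"
  shows "graph (G \<restriction> S)"
proof -
  have i: "induced_subgraph (G \<restriction> S) G" using assms by (rule induced_induce)
  interpret H: digraph "G \<restriction> S" using i by (rule digraphI_induced)
  interpret H: sym_digraph "G \<restriction> S" using i by (rule induced_graph_imp_graph)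
  show ?thesis by unfold_locales
qed

text \<open>
  Each edge inside \<open>U\<close> is counted once, at its end of lower rank.
\<close>

lemma (in graph) sum_later_neighbours_eq_card_edges:
  fixes \<rho> :: "'a \<Rightarrow> nat"
  assumes U: "U \<subseteq> verts G" and inj: "inj_on \<rho> U"
  shows "(\<Sum>u\<in>U. card {w \<in> U. u \<rightarrow>\<^bsub>G\<^esub> w \<and> \<rho> u < \<rho> w}) = card (edges (G \<restriction> U))"
proof -
  define D where "D = (SIGMA u:U. {w \<in> U. u \<rightarrow>\<^bsub>G\<^esub> w \<and> \<rho> u < \<rho> w})"
  have fin: "finite U" using U finite_verts by (rule finite_subset)
  have "edges (G \<restriction> U) = (\<lambda>(u, w). {u, w}) ` D"
  proof safe
    fix e assume "e \<in> edges (G \<restriction> U)"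
    then obtain u w where e: "e = {u, w}" "u \<rightarrow>\<^bsub>G\<^esub> w" "u \<in> U" "w \<in> U"
      by (auto simp: edges_def dominates_induce_subgraph_iff)
    then have "\<rho> u \<noteq> \<rho> w" using inj not_dominates_self by (auto dest: inj_onD)
    then have "(u, w) \<in> D \<or> (w, u) \<in> D"
      using e dominates_sym[of u w] by (auto simp: D_def)
    then show "e \<in> (\<lambda>(u, w). {u, w}) ` D" using e(1) by (auto simp: insert_commute intro: rev_image_eqI)
  qed (auto simp: D_def edges_def dominates_induce_subgraph_iff)
  moreover have "inj_on (\<lambda>(u, w). {u, w}) D"
    by (auto simp: inj_on_def D_def doubleton_eq_iff)
  ultimately have "card (edges (G \<restriction> U)) = card D" by (simp add: card_image)
  then show ?thesis using fin by (simp add: D_def)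
qed

section \<open>The Laplacian as a quadratic form\<close>

text \<open>
  The quadratic form of the Laplacian, polarized and written as a sum over edges. Every undirected edge is
  a pair of opposite arcs, hence the division by 2. Functions on the vertices replace coordinate vectors,
  so that the forms of a graph and of its subgraphs apply to the same functions.
\<close>

definition dirichlet_form :: "('a, 'b) pre_digraph \<Rightarrow> ('a \<Rightarrow> real) \<Rightarrow> ('a \<Rightarrow> real) \<Rightarrow> real" where
  "dirichlet_form G f g = (\<Sum>(a, b)\<in>arcs_ends G. (f a - f b) * (g a - g b)) / 2"

lemma (in graph) dirichlet_form_eq:
  "dirichlet_form G f g = (\<Sum>x\<in>verts G. f x * (\<Sum>w | x \<rightarrow>\<^bsub>G\<^esub> w. g x - g w))"
proof -
  have bij: "bij_betw (\<lambda>(a, b). (b, a)) (arcs_ends G) (arcs_ends G)"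
    by (rule bij_betwI[of _ _ _ "\<lambda>(a, b). (b, a)"]) (auto intro: dominates_sym)
  have "(\<Sum>(a, b)\<in>arcs_ends G. f b * (g a - g b)) = (\<Sum>(a, b)\<in>arcs_ends G. f a * (g b - g a))"
    using sum.reindex_bij_betw[OF bij, of "\<lambda>(a, b). f b * (g a - g b)"]
    by (simp add: case_prod_unfold)
  also have "\<dots> = - (\<Sum>(a, b)\<in>arcs_ends G. f a * (g a - g b))"
    unfolding sum_negf[symmetric] by (intro sum.cong) (auto simp: algebra_simps)
  finally have sw: "(\<Sum>(a, b)\<in>arcs_ends G. f b * (g a - g b)) =
      - (\<Sum>(a, b)\<in>arcs_ends G. f a * (g a - g b))" .
  have "(\<Sum>(a, b)\<in>arcs_ends G. (f a - f b) * (g a - g b)) =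
      (\<Sum>(a, b)\<in>arcs_ends G. f a * (g a - g b)) - (\<Sum>(a, b)\<in>arcs_ends G. f b * (g a - g b))"
    unfolding sum_subtractf[symmetric] by (intro sum.cong) (auto simp: algebra_simps)
  then have "dirichlet_form G f g = (\<Sum>(a, b)\<in>arcs_ends G. f a * (g a - g b))"
    by (simp add: dirichlet_form_def sw)
  also have "arcs_ends G = (SIGMA x:verts G. {w. x \<rightarrow>\<^bsub>G\<^esub> w})" using dominates_in_verts by auto
  also have "(\<Sum>(a, b)\<in>\<dots>. f a * (g a - g b)) =
      (\<Sum>x\<in>verts G. \<Sum>w | x \<rightarrow>\<^bsub>G\<^esub> w. f x * (g x - g w))"
    using finite_neighbours by (subst sum.Sigma) auto
  finally show ?thesis by (simp add: sum_distrib_left)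
qed

lemma dirichlet_form_cauchy_schwarz:
  "(dirichlet_form G f g)\<^sup>2 \<le> dirichlet_form G f f * dirichlet_form G g g"
  using Cauchy_Schwarz_ineq_sum[of "\<lambda>(a, b). f a - f b" "\<lambda>(a, b). g a - g b" "arcs_ends G"]
  by (simp add: dirichlet_form_def case_prod_unfold power2_eq_square)

lemma vec_nth_scalar_prod:
  fixes f g :: "'a \<Rightarrow> real"
  assumes "distinct vs"
  shows "vec (length vs) (\<lambda>i. f (vs ! i)) \<bullet> vec (length vs) (\<lambda>i. g (vs ! i)) =
    (\<Sum>x\<in>set vs. f x * g x)"
  using sum.reindex_bij_betw[OF bij_betw_nth[OF assms refl refl], of "\<lambda>x. f x * g x"]
  by (simp add: scalar_prod_def atLeast0LessThan)

lemma (in graph) laplacian_matrix_sym: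
  assumes "i < length vs" "j < length vs"
  shows "laplacian_matrix G vs $$ (i, j) = laplacian_matrix G vs $$ (j, i)"
  using assms dominates_sym by (auto simp: laplacian_matrix_index)

lemma (in graph) laplacian_matrix_mult_vec:
  fixes g :: "'a \<Rightarrow> real"
  assumes vs: "distinct vs" "set vs = verts G"
  shows "laplacian_matrix G vs *\<^sub>v vec (length vs) (\<lambda>i. g (vs ! i)) =
    vec (length vs) (\<lambda>i. \<Sum>w | vs ! i \<rightarrow>\<^bsub>G\<^esub> w. g (vs ! i) - g w)"
proof (rule eq_vecI)
  fix i assume "i < dim_vec (vec (length vs) (\<lambda>i. \<Sum>w | vs ! i \<rightarrow>\<^bsub>G\<^esub> w. g (vs ! i) - g w))"
  then have i: "i < length vs" by simp
  define x where "x = vs ! i"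
  have sub: "verts G \<inter> {w. x \<rightarrow>\<^bsub>G\<^esub> w} = {w. x \<rightarrow>\<^bsub>G\<^esub> w}" using dominates_in_verts by auto
  have "(laplacian_matrix G vs *\<^sub>v vec (length vs) (\<lambda>i. g (vs ! i))) $ i =
      (\<Sum>j<length vs. laplacian_matrix G vs $$ (i, j) * g (vs ! j))"
    using i carrier_matD[OF laplacian_matrix_carrier[of G vs]]
    by (simp add: scalar_prod_def atLeast0LessThan)
  also have "\<dots> = (\<Sum>j<length vs. (if vs ! j = x then real (out_degree G x) * g x else 0)
      - (if x \<rightarrow>\<^bsub>G\<^esub> vs ! j then g (vs ! j) else 0))"
    using i vs(1) by (intro sum.cong)
      (auto simp: laplacian_matrix_index x_def nth_eq_iff_index_eq algebra_simps)
  also have "\<dots> = (\<Sum>y\<in>verts G. (if y = x then real (out_degree G x) * g x else 0)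
      - (if x \<rightarrow>\<^bsub>G\<^esub> y then g y else 0))"
    by (rule sum.reindex_bij_betw[OF bij_betw_nth]) (use vs in auto)
  also have "\<dots> = real (out_degree G x) * g x - (\<Sum>w | x \<rightarrow>\<^bsub>G\<^esub> w. g w)"
  proof -
    have "x \<in> verts G" unfolding x_def using nth_mem[OF i] vs(2) by simp
    moreover have "(\<Sum>y\<in>verts G. if x \<rightarrow>\<^bsub>G\<^esub> y then g y else 0) = (\<Sum>w | x \<rightarrow>\<^bsub>G\<^esub> w. g w)"
      using sum.inter_restrict[OF finite_verts, of g "{w. x \<rightarrow>\<^bsub>G\<^esub> w}"]
      unfolding sub mem_Collect_eq by (rule sym)
    ultimately show ?thesis by (simp add: sum_subtractf)
  qed
  also have "\<dots> = (\<Sum>w | x \<rightarrow>\<^bsub>G\<^esub> w. g x - g w)"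
    by (simp add: sum_subtractf out_degree_eq_card_neighbours)
  finally show "(laplacian_matrix G vs *\<^sub>v vec (length vs) (\<lambda>i. g (vs ! i))) $ i =
      vec (length vs) (\<lambda>i. \<Sum>w | vs ! i \<rightarrow>\<^bsub>G\<^esub> w. g (vs ! i) - g w) $ i"
    using i by (simp add: x_def)
qed (simp add: carrier_matD[OF laplacian_matrix_carrier])

lemma (in graph) laplacian_matrix_dirichlet_form:
  fixes f g :: "'a \<Rightarrow> real"
  assumes vs: "distinct vs" "set vs = verts G"
  shows "vec (length vs) (\<lambda>i. f (vs ! i)) \<bullet>
      (laplacian_matrix G vs *\<^sub>v vec (length vs) (\<lambda>i. g (vs ! i))) = dirichlet_form G f g"
  using vec_nth_scalar_prod[OF vs(1), of f "\<lambda>x. \<Sum>w | x \<rightarrow>\<^bsub>G\<^esub> w. g x - g w"] vs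
  by (simp add: laplacian_matrix_mult_vec dirichlet_form_eq)

lemma vec_eq_vec_nth:
  assumes "distinct vs" "x \<in> carrier_vec (length vs)"
  obtains f where "x = vec (length vs) (\<lambda>i. f (vs ! i))"
proof
  show "x = vec (length vs) (\<lambda>i. x $ (inv_into {..<length vs} (nth vs) (vs ! i)))"
    using assms inj_on_nth[OF assms(1), of "{..<length vs}"]
    by (intro eq_vecI) (auto simp: inv_into_f_f)
qed

lemma (in graph) vertex_enumeration:
  obtains vs where "distinct vs" "set vs = verts G" "length vs = card (verts G)"
  using finite_distinct_list[OF finite_verts] distinct_card by metis

text \<open>
  The eigenvalue equation \<open>L z = \<theta> z\<close> in weak form, which is meaningful without an enumeration of the
  vertices.
\<close>

lemma (in graph) top_laplacian_eigenfunction: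
  assumes "verts G \<noteq> {}"
  obtains z where "(\<Sum>x\<in>verts G. (z x)\<^sup>2) = 1"
    "\<And>g. dirichlet_form G z g = laplacian_eigenvalue G 1 * (\<Sum>x\<in>verts G. z x * g x)"
proof -
  obtain vs where vs: "distinct vs" "set vs = verts G" by (rule vertex_enumeration)
  define n where "n = length vs"
  define L where "L = laplacian_matrix G vs"
  have L: "L \<in> carrier_mat n n" by (simp add: L_def n_def)
  have sym: "L $$ (i, j) = L $$ (j, i)" if "i < n" "j < n" for i j
    using that by (simp add: L_def n_def laplacian_matrix_sym)
  have n: "0 < n" using assms vs by (auto simp: n_def)
  obtain v where v: "v \<in> carrier_vec n" "L *\<^sub>v v = laplacian_eigenvalue G 1 \<cdot>\<^sub>v v" "v \<bullet> v = 1"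
  proof (rule real_symmetric_sorted_eigenbasis[OF L sym])
    fix u
    assume "\<And>i. i < n \<Longrightarrow> u i \<in> carrier_vec n"
      "\<And>i. i < n \<Longrightarrow> L *\<^sub>v u i =
        rev (sorted_list_of_multiset (proots (char_poly L))) ! i \<cdot>\<^sub>v u i"
      "\<And>i j. i < n \<Longrightarrow> j < n \<Longrightarrow> u i \<bullet> u j = (if i = j then 1 else 0)"
    with n show thesis
      by (intro that[of "u 0"]) (auto simp: laplacian_eigenvalue_def laplacian_spectrum_eq[OF vs] L_def)
  qed
  obtain z where z: "v = vec n (\<lambda>i. z (vs ! i))"
    using vec_eq_vec_nth[OF vs(1)] v(1) unfolding n_def by blast
  show thesis
  proof (rule that[of z])
    show "(\<Sum>x\<in>verts G. (z x)\<^sup>2) = 1"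
      using v(3) vec_nth_scalar_prod[OF vs(1), of z z]
      by (simp add: z n_def vs(2) power2_eq_square)
    fix g :: "'a \<Rightarrow> real"
    define w where "w = vec n (\<lambda>i. g (vs ! i))"
    have w: "w \<in> carrier_vec n" by (simp add: w_def)
    have "dirichlet_form G z g = v \<bullet> (L *\<^sub>v w)"
      unfolding z w_def L_def n_def by (rule laplacian_matrix_dirichlet_form[OF vs, symmetric])
    also have "\<dots> = (L *\<^sub>v v) \<bullet> w" using symmetric_scalar_prod[OF L sym v(1) w] by simp
    also have "\<dots> = laplacian_eigenvalue G 1 * (v \<bullet> w)" using v(1) w by (simp add: v(2))
    also have "v \<bullet> w = (\<Sum>x\<in>verts G. z x * g x)"
      unfolding z w_def n_def using vec_nth_scalar_prod[OF vs(1)] vs(2) by simp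
    finally show "dirichlet_form G z g = laplacian_eigenvalue G 1 * (\<Sum>x\<in>verts G. z x * g x)" .
  qed
qed

text \<open>
  The maximum principle for the Laplacian, with functions on the vertices in place of vectors.
\<close>

lemma (in graph) sum_norms_le_sum_laplacian_eigenvalues:
  fixes y :: "'j \<Rightarrow> 'a \<Rightarrow> real"
  assumes J: "finite J" "card J \<le> card (verts G)"
    and dom: "\<And>g. (\<Sum>j\<in>J. (\<Sum>x\<in>verts G. y j x * g x)\<^sup>2) \<le> dirichlet_form G g g"
  shows "(\<Sum>j\<in>J. \<Sum>x\<in>verts G. (y j x)\<^sup>2) \<le> (\<Sum>i = 1..card J. laplacian_eigenvalue G i)"
proof -
  obtain vs where vs: "distinct vs" "set vs = verts G" "length vs = card (verts G)"
    by (rule vertex_enumeration)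
  define n where "n = length vs"
  define L where "L = laplacian_matrix G vs"
  define Y where "Y j = vec n (\<lambda>i. y j (vs ! i))" for j
  have "(\<Sum>j\<in>J. Y j \<bullet> Y j) \<le>
      (\<Sum>i<card J. rev (sorted_list_of_multiset (proots (char_poly L))) ! i)"
  proof (rule sum_norms_le_sum_top_eigenvalues[where n = n])
    show "L \<in> carrier_mat n n" by (simp add: L_def n_def)
    show "L $$ (i, j) = L $$ (j, i)" if "i < n" "j < n" for i j
      using that by (simp add: L_def n_def laplacian_matrix_sym)
    show "card J \<le> n" using J vs by (simp add: n_def)
    fix x :: "real vec" assume "x \<in> carrier_vec n"
    then obtain g where x: "x = vec n (\<lambda>i. g (vs ! i))"
      using vec_eq_vec_nth[OF vs(1)] unfolding n_def by blast
    have "(\<Sum>j\<in>J. (Y j \<bullet> x)\<^sup>2) = (\<Sum>j\<in>J. (\<Sum>x\<in>verts G. y j x * g x)\<^sup>2)"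
      unfolding x Y_def n_def using vec_nth_scalar_prod[OF vs(1)] vs(2) by simp
    also have "\<dots> \<le> dirichlet_form G g g" by (rule dom)
    also have "\<dots> = x \<bullet> (L *\<^sub>v x)"
      unfolding x L_def n_def by (rule laplacian_matrix_dirichlet_form[OF vs(1,2), symmetric])
    finally show "(\<Sum>j\<in>J. (Y j \<bullet> x)\<^sup>2) \<le> x \<bullet> (L *\<^sub>v x)" .
  qed (use J in \<open>auto simp: Y_def\<close>)
  also have "\<dots> = (\<Sum>i<card J. laplacian_eigenvalue G (Suc i))"
    by (simp add: laplacian_eigenvalue_def laplacian_spectrum_eq[OF vs(1,2)] L_def)
  also have "\<dots> = (\<Sum>i = 1..card J. laplacian_eigenvalue G i)"
    by (simp add: sum.atLeast1_atMost_eq)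
  finally show ?thesis
    using vec_nth_scalar_prod[OF vs(1)] vs(2) by (simp add: Y_def n_def power2_eq_square)
qed

section \<open>The lower bound\<close>

text \<open>
  The edges oriented by \<open>out\<close> and the edges inside the complement of \<open>U\<close> are disjoint. Orientation is
  one-way, so that each edge of the first kind is one arc from \<open>out\<close> and one reversed arc.
\<close>

lemma (in graph) dirichlet_form_split:
  assumes U: "U \<subseteq> verts G"
    and out: "\<And>u w. u \<in> U \<Longrightarrow> w \<in> out u \<Longrightarrow> u \<rightarrow>\<^bsub>G\<^esub> w"
    and anti: "\<And>u w. u \<in> U \<Longrightarrow> w \<in> out u \<Longrightarrow> w \<in> U \<Longrightarrow> u \<notin> out w"
  shows "(\<Sum>u\<in>U. \<Sum>w\<in>out u. (g u - g w)\<^sup>2) + dirichlet_form (G \<restriction> (verts G - U)) g g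
    \<le> dirichlet_form G g g"
proof -
  define q where "q = (\<lambda>(a, b). (g a - g b)\<^sup>2 :: real)"
  define P where "P = Sigma U out"
  define P' where "P' = (\<lambda>(a, b). (b, a)) ` P"
  define W where "W = arcs_ends (G \<restriction> (verts G - U))"
  have finU: "finite U" using U finite_verts by (rule finite_subset)
  have fin_out: "finite (out u)" if "u \<in> U" for u
    by (rule finite_subset[OF _ finite_neighbours[of u]]) (use out[OF that] in auto)
  have sub: "P \<subseteq> arcs_ends G" "P' \<subseteq> arcs_ends G" "W \<subseteq> arcs_ends G"
    using out by (auto simp: P_def P'_def W_def dominates_induce_subgraph_iff intro: dominates_sym)
  have fin: "finite P" "finite P'" "finite W"
    using sub finite_arcs_ends by (auto intro: finite_subset)
  have disj: "P \<inter> P' = {}" "(P \<union> P') \<inter> W = {}"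
    using anti by (auto simp: P_def P'_def W_def dominates_induce_subgraph_iff)
  have form: "dirichlet_form H g g = sum q (arcs_ends H) / 2" for H :: "('a, 'b) pre_digraph"
    by (simp add: dirichlet_form_def q_def power2_eq_square)
  have "sum q P' = sum q P"
    unfolding P'_def by (subst sum.reindex) (auto simp: inj_on_def q_def power2_commute intro!: sum.cong)
  moreover have "sum q P = (\<Sum>u\<in>U. \<Sum>w\<in>out u. (g u - g w)\<^sup>2)"
    unfolding P_def q_def using finU fin_out by (subst sum.Sigma) auto
  moreover have "sum q P + sum q P' + sum q W = sum q (P \<union> P' \<union> W)"
    using fin disj by (simp add: sum.union_disjoint)
  moreover have "\<dots> \<le> sum q (arcs_ends G)"
    using sub finite_arcs_ends by (intro sum_mono2) (auto simp: q_def)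
  ultimately show ?thesis by (simp add: form flip: W_def)
qed

theorem theorem3p2:
  fixes G :: "('a, 'b) pre_digraph" and U :: "'a set"
  assumes "graph G"
    and "Digraph_Component.connected G"
    and "card (verts G) > 2"
    and "U \<subseteq> verts G"
    and "card U < card (verts G)"
  shows "(\<Sum>i = 1..card U + 1. laplacian_eigenvalue G i) \<ge>
    (\<Sum>u\<in>U. real (out_degree G u)) + real (card U) - real (card (edges (G \<restriction> U)))
      + laplacian_eigenvalue (G \<restriction> (verts G - U)) 1"
proof -
  interpret graph G by fact
  note U = \<open>U \<subseteq> verts G\<close>
  define V' where "V' = verts G - U"
  define G' where "G' = G \<restriction> V'"
  define \<theta> where "\<theta> = laplacian_eigenvalue G' 1"
  have finU: "finite U" using U finite_verts by (rule finite_subset)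
  have "V' \<noteq> {}" using assms(5) U unfolding V'_def by auto
  moreover have "graph G'" unfolding G'_def V'_def by (rule graph_induce_subgraph) auto
  moreover have verts_G': "verts G' = V'" by (simp add: G'_def)
  ultimately obtain z where z: "(\<Sum>x\<in>V'. (z x)\<^sup>2) = 1"
    "\<And>g. dirichlet_form G' z g = \<theta> * (\<Sum>x\<in>V'. z x * g x)"
    unfolding \<theta>_def using graph.top_laplacian_eigenfunction[of G'] by metis
  have \<theta>: "\<theta> \<ge> 0"
  proof -
    have "\<theta> = dirichlet_form G' z z" using z by (simp add: power2_eq_square)
    also have "\<dots> \<ge> 0" unfolding dirichlet_form_def by (auto intro!: sum_nonneg)
    finally show ?thesis .
  qed
  obtain \<rho> :: "'a \<Rightarrow> nat" where inj: "inj_on \<rho> U"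
    and \<rho>: "\<And>u. u \<in> U \<Longrightarrow> \<exists>w. u \<rightarrow>\<^bsub>G\<^esub> w \<and> (w \<notin> U \<or> \<rho> w < \<rho> u)"
  proof -
    have "\<exists>w\<in>W. \<exists>x. x \<notin> W \<and> w \<rightarrow>\<^bsub>G\<^esub> x" if "W \<subseteq> U" "W \<noteq> {}" for W
      using that U assms(2,5) by (intro connected_arc_leaving) auto
    from exists_ranking_towards_complement[of U "\<lambda>u w. u \<rightarrow>\<^bsub>G\<^esub> w", OF finU this]
    show thesis using that by blast
  qed
  define out where "out u = {w. u \<rightarrow>\<^bsub>G\<^esub> w \<and> (w \<notin> U \<or> \<rho> w < \<rho> u)}" for u
  define d where "d u = real (card (out u))" for u
  have fin_out: "finite (out u)" for u
    by (rule finite_subset[OF _ finite_neighbours[of u]]) (auto simp: out_def)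
  have d_pos: "d u > 0" if "u \<in> U" for u
    using \<rho>[OF that] fin_out[of u] by (auto simp: d_def card_gt_0_iff out_def)
  have self: "u \<notin> out u" for u by (simp add: out_def not_dominates_self)
  have out_verts: "out u \<subseteq> verts G" for u using dominates_in_verts by (auto simp: out_def)

  \<comment> \<open>Test functions: \<open>y None\<close> is the top eigenfunction of \<open>G'\<close>, scaled to squared norm \<open>\<theta>\<close>. For \<open>u\<close> in \<open>U\<close>,
    \<open>y (Some u)\<close> is the image, under the oriented incidence matrix, of the unit vector in edge space that
    is constant on the \<open>d u\<close> edges leaving \<open>u\<close>.\<close>
  define y where "y j x = (case j of
      None \<Rightarrow> if x \<in> V' then sqrt \<theta> * z x else 0
    | Some u \<Rightarrow> if x = u then sqrt (d u) else if x \<in> out u then - 1 / sqrt (d u) else 0)" for j x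
  have yNone: "(\<Sum>x\<in>verts G. y None x * g x) = sqrt \<theta> * (\<Sum>x\<in>V'. z x * g x)" for g
  proof -
    have "(\<Sum>x\<in>verts G. y None x * g x) = (\<Sum>x\<in>V'. y None x * g x)"
      by (rule sum.mono_neutral_right) (auto simp: y_def V'_def)
    then show ?thesis by (simp add: y_def sum_distrib_left mult_ac)
  qed
  have ySome: "(\<Sum>x\<in>verts G. y (Some u) x * g x) = (\<Sum>w\<in>out u. g u - g w) / sqrt (d u)"
    if u: "u \<in> U" for u g
  proof -
    have "(\<Sum>x\<in>verts G. y (Some u) x * g x) = (\<Sum>x\<in>insert u (out u). y (Some u) x * g x)"
      using u U out_verts by (intro sum.mono_neutral_right) (auto simp: y_def)
    also have "\<dots> = sqrt (d u) * g u + (\<Sum>x\<in>out u. - (g x / sqrt (d u)))"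
      using fin_out self by (auto simp: y_def intro!: sum.cong)
    also have "\<dots> = (d u * g u - (\<Sum>w\<in>out u. g w)) / sqrt (d u)"
      using d_pos[OF u]
      by (simp add: sum_negf real_div_sqrt diff_divide_distrib flip: sum_divide_distrib times_divide_eq_left)
    finally show ?thesis by (simp add: sum_subtractf d_def)
  qed
  define J where "J = insert None (Some ` U)"
  have J: "finite J" "card J = card U + 1"
    using finU by (auto simp: J_def card_image)
  have sumJ: "sum h J = h None + (\<Sum>u\<in>U. h (Some u))" for h :: "'a option \<Rightarrow> real"
    using finU by (simp add: J_def sum.reindex)
  have "(\<Sum>j\<in>J. (\<Sum>x\<in>verts G. y j x * g x)\<^sup>2) \<le> dirichlet_form G g g" for g
  proof -
    define s where "s = (\<Sum>x\<in>V'. z x * g x)"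
    have "(\<Sum>x\<in>verts G. y None x * g x)\<^sup>2 = \<theta> * s\<^sup>2"
      using \<theta> by (simp add: yNone power_mult_distrib s_def)
    also have "\<theta> * s\<^sup>2 \<le> dirichlet_form G' g g"
    proof (cases "\<theta> = 0")
      case True
      then show ?thesis unfolding dirichlet_form_def by (auto intro!: sum_nonneg)
    next
      case False
      have "\<theta> * (\<theta> * s\<^sup>2) = (dirichlet_form G' z g)\<^sup>2"
        by (simp add: z(2) s_def power2_eq_square)
      also have "\<dots> \<le> dirichlet_form G' z z * dirichlet_form G' g g"
        by (rule dirichlet_form_cauchy_schwarz)
      also have "dirichlet_form G' z z = \<theta>" using z by (simp add: power2_eq_square)
      finally show ?thesis using False \<theta> by simp
    qed
    finally have 0: "(\<Sum>x\<in>verts G. y None x * g x)\<^sup>2 \<le> dirichlet_form G' g g" .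
    have 1: "(\<Sum>x\<in>verts G. y (Some u) x * g x)\<^sup>2 \<le> (\<Sum>w\<in>out u. (g u - g w)\<^sup>2)"
      if u: "u \<in> U" for u
    proof -
      have "(\<Sum>w\<in>out u. g u - g w)\<^sup>2 \<le> (\<Sum>w\<in>out u. (g u - g w)\<^sup>2) * d u"
        unfolding d_def by (rule sum_squared_le_sum_of_squares)
      then show ?thesis using d_pos[OF u]
        by (simp add: ySome[OF u] power_divide divide_le_eq)
    qed
    have "(\<Sum>j\<in>J. (\<Sum>x\<in>verts G. y j x * g x)\<^sup>2) \<le>
        dirichlet_form G' g g + (\<Sum>u\<in>U. \<Sum>w\<in>out u. (g u - g w)\<^sup>2)"
      unfolding sumJ by (intro add_mono sum_mono 0 1)
    also have "\<dots> \<le> dirichlet_form G g g"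
      unfolding G'_def V'_def
      using dirichlet_form_split[OF U, of out g] by (force simp: out_def)
    finally show ?thesis .
  qed
  then have "(\<Sum>j\<in>J. \<Sum>x\<in>verts G. (y j x)\<^sup>2) \<le> (\<Sum>i = 1..card J. laplacian_eigenvalue G i)"
    using J assms(5) by (intro sum_norms_le_sum_laplacian_eigenvalues) auto
  also have "(\<Sum>j\<in>J. \<Sum>x\<in>verts G. (y j x)\<^sup>2) = \<theta> + (\<Sum>u\<in>U. d u + 1)"
  proof -
    have "(\<Sum>x\<in>verts G. (y None x)\<^sup>2) = sqrt \<theta> * (\<Sum>x\<in>V'. z x * y None x)"
      unfolding power2_eq_square by (rule yNone)
    also have "(\<Sum>x\<in>V'. z x * y None x) = sqrt \<theta> * (\<Sum>x\<in>V'. (z x)\<^sup>2)"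
      unfolding sum_distrib_left by (intro sum.cong) (auto simp: y_def power2_eq_square)
    also have "sqrt \<theta> * (sqrt \<theta> * (\<Sum>x\<in>V'. (z x)\<^sup>2)) = \<theta> * (\<Sum>x\<in>V'. (z x)\<^sup>2)"
      using \<theta> by (simp flip: mult.assoc)
    finally have 0: "(\<Sum>x\<in>verts G. (y None x)\<^sup>2) = \<theta>" using z by simp
    have 1: "(\<Sum>x\<in>verts G. (y (Some u) x)\<^sup>2) = d u + 1" if u: "u \<in> U" for u
    proof -
      have "(\<Sum>x\<in>verts G. (y (Some u) x)\<^sup>2) =
          (\<Sum>w\<in>out u. y (Some u) u - y (Some u) w) / sqrt (d u)"
        unfolding power2_eq_square by (rule ySome[OF u])
      also have "\<dots> = (\<Sum>w\<in>out u. (sqrt (d u) + 1 / sqrt (d u)) / sqrt (d u))"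
        unfolding sum_divide_distrib using self[of u] by (intro sum.cong) (auto simp: y_def)
      also have "\<dots> = d u * ((sqrt (d u) + 1 / sqrt (d u)) / sqrt (d u))" by (simp add: d_def)
      also have "\<dots> = d u + 1" using d_pos[OF u] by (simp add: field_simps)
      finally show ?thesis .
    qed
    show ?thesis unfolding sumJ 0 using 1 by simp
  qed
  also have "(\<Sum>u\<in>U. d u + 1) =
      (\<Sum>u\<in>U. real (out_degree G u)) + real (card U) - real (card (edges (G \<restriction> U)))"
  proof -
    have "real (out_degree G u) = d u + real (card {w \<in> U. u \<rightarrow>\<^bsub>G\<^esub> w \<and> \<rho> u < \<rho> w})"
      if u: "u \<in> U" for u
    proof -
      \<comment> \<open>An edge at \<open>u\<close> that is not outgoing joins \<open>u\<close> to a vertex of \<open>U\<close> of higher rank.\<close>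
      have "{w. u \<rightarrow>\<^bsub>G\<^esub> w} = out u \<union> {w \<in> U. u \<rightarrow>\<^bsub>G\<^esub> w \<and> \<rho> u < \<rho> w}"
        using inj u not_dominates_self by (auto simp: out_def dest: inj_onD) (metis inj_onD linorder_neqE_nat)
      moreover have "out u \<inter> {w \<in> U. u \<rightarrow>\<^bsub>G\<^esub> w \<and> \<rho> u < \<rho> w} = {}" by (auto simp: out_def)
      ultimately show ?thesis
        using fin_out finU by (simp add: out_degree_eq_card_neighbours d_def card_Un_disjoint)
    qed
    then have "(\<Sum>u\<in>U. real (out_degree G u)) =
        (\<Sum>u\<in>U. d u) + real (\<Sum>u\<in>U. card {w \<in> U. u \<rightarrow>\<^bsub>G\<^esub> w \<and> \<rho> u < \<rho> w})"
      by (simp add: sum.distrib)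
    then show ?thesis
      unfolding sum_later_neighbours_eq_card_edges[OF U inj] by (simp add: sum.distrib)
  qed
  finally show ?thesis unfolding J(2) \<theta>_def G'_def V'_def by simp
qed

end
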